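(* There exist abyssal numbers $\theta,\eta\in\mathfrak W$ such that for every $\mu\in\mathbb P_\varepsilon$ the groups ${}^*\mathbb Z^\mu_\mu(\theta)$ and ${}^*\mathbb Z^\mu_\mu(\eta)$ are not both nonzero (i.e. the flat product of $\theta$ and $\eta$ is undefined for all $\mu$). In fact, for any $\kappa,\kappa'\in[1,\infty]$, one can find such a pair with $\theta\in\mathfrak W_\kappa$ and $\eta\in\mathfrak W_{\kappa'}$.
   Context: Fix a nonprincipal ultrafilter $\mathfrak u$ on $\mathbb N$, and let ${}^*\mathbb Z\subset{}^*\mathbb R$ be the ultrapowers of $\mathbb Z\subset\mathbb R$. Let ${}^*\mathbb R_{\rm fin}$ be the ring of bounded elements, ${}^*\mathbb R_\varepsilon$ its ideal of infinitesimals, and $({}^*\mathbb R_{\rm fin})^\times_+$ the multiplicative group of positive elements that are neither infinite nor infinitesimal. Let $\mathbb P:=({}^*\mathbb R_{>0}\cup\{0\})/({}^*\mathbb R_{\rm fin})^\times_+$; write $\langle x\rangle\in\mathbb P$ for the class of $|x|$, and $-\infty:=\langle0\rangle$. $\mathbb P$ has the induced product and total order ($\mu<\mu'$ iff $x<x'$ for all representatives; $-\infty$ is the minimum). $\mathbb P_\varepsilon\subset\mathbb P$ is the set of classes of positive infinitesimals. For $0\ne n\in{}^*\mathbb Z$ the growth is $\mu(n):=\langle n\rangle^{-1}$. For $\theta\in\mathbb R$, ${}^*\mathbb Z(\theta)$ is the group of $n\in{}^*\mathbb Z$ for which there is a (unique) $n^\perp\in{}^*\mathbb Z$ with $\varepsilon(n):=n\theta-n^\perp\in{}^*\mathbb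 R_\varepsilon$; the decay of $n\in{}^*\mathbb Z(\theta)$ is $\nu(n):=\langle\varepsilon(n)\rangle$. For $\mu,\nu\in\mathbb P_\varepsilon$, ${}^*\mathbb Z^\mu_\nu(\theta):=\{0\neq n\in{}^*\mathbb Z(\theta):\mu(n)>\mu,\ \nu(n)\le\nu\}\cup\{0\}$. Let $\|\cdot\|$ be the distance to the nearest integer. $\mathfrak W$ is the set of irrational $\theta$ with $\liminf_{n\to\infty}n\|n\theta\|=0$. For real $\kappa\ge1$, $\mathfrak W_\kappa$ is the set of irrational $\theta$ such that $\|n\theta\|<n^{-\kappa}$ for infinitely many $n\in\mathbb N$; $\mathfrak W_\infty=\bigcap_{\kappa>1}\mathfrak W_\kappa$ is the set of Liouville numbers. An irrational $\theta$ with partial quotients $[a_0a_1a_2\dots]$ is abyssal if there is a sequence of pairwise disjoint blocks of consecutive partial quotients $B_n=\{a_{i_n},a_{i_n+1},\dots,a_{i_n+k_n}\}$, all of whose elements are bounded by a constant independent of $n$, with $k_n\to\infty$. *)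

theory Defs
  imports Complex_Main "HOL-Library.Extended_Real" "HOL-Library.Disjoint_Sets"
begin

definition nonprincipal_ultrafilter :: "nat filter \<Rightarrow> bool" where
  "nonprincipal_ultrafilter U \<longleftrightarrow>
     U \<noteq> bot \<and>
     (\<forall>P. eventually P U \<or> eventually (\<lambda>i. \<not> P i) U) \<and>
     (\<forall>i. U \<noteq> principal {i})"

subsection \<open>Ultrapowers\<close>

text \<open>The ultrafilter is a parameter, so the ultrapower is not a type but a set of
  equivalence classes of sequences; operations and relations are lifted to classes
  through representatives.\<close>

type_synonym hyperreal = "(nat \<Rightarrow> real) set"

definition ultra_rel :: "nat filter \<Rightarrow> ((nat \<Rightarrow> 'a) \<times> (nat \<Rightarrow> 'a)) set" where
  "ultra_rel U = {(f, g). eventually (\<lambda>i. f i = g i) U}"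

definition ultra_class :: "nat filter \<Rightarrow> (nat \<Rightarrow> 'a) \<Rightarrow> (nat \<Rightarrow> 'a) set" where
  "ultra_class U f = ultra_rel U `` {f}"

definition ultrapower :: "nat filter \<Rightarrow> (nat \<Rightarrow> 'a) set set" where
  "ultrapower U = UNIV // ultra_rel U"

definition ultra_const :: "nat filter \<Rightarrow> 'a \<Rightarrow> (nat \<Rightarrow> 'a) set" where
  "ultra_const U c = ultra_class U (\<lambda>_. c)"

definition ultra_map :: "nat filter \<Rightarrow> ('a \<Rightarrow> 'b) \<Rightarrow> (nat \<Rightarrow> 'a) set \<Rightarrow> (nat \<Rightarrow> 'b) set" where
  "ultra_map U h x = {k. \<exists>f\<in>x. eventually (\<lambda>i. k i = h (f i)) U}"

definition ultra_map2 :: "nat filter \<Rightarrow> ('a \<Rightarrow> 'b \<Rightarrow> 'c) \<Rightarrow>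
    (nat \<Rightarrow> 'a) set \<Rightarrow> (nat \<Rightarrow> 'b) set \<Rightarrow> (nat \<Rightarrow> 'c) set" where
  "ultra_map2 U h x y = {k. \<exists>f\<in>x. \<exists>g\<in>y. eventually (\<lambda>i. k i = h (f i) (g i)) U}"

definition ultra_lift2 :: "nat filter \<Rightarrow> ('a \<Rightarrow> 'b \<Rightarrow> bool) \<Rightarrow>
    (nat \<Rightarrow> 'a) set \<Rightarrow> (nat \<Rightarrow> 'b) set \<Rightarrow> bool" where
  "ultra_lift2 U R x y \<longleftrightarrow> (\<exists>f\<in>x. \<exists>g\<in>y. eventually (\<lambda>i. R (f i) (g i)) U)"

lemma equiv_ultra_rel: "equiv UNIV (ultra_rel U :: ((nat \<Rightarrow> 'a) \<times> _) set)" (is "equiv _ ?R")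
proof (rule equivI)
  show "refl_on UNIV ?R" by (auto simp: ultra_rel_def refl_on_def)
  show "sym ?R" by (auto simp: ultra_rel_def eq_commute intro: symI)
  show "trans ?R"
  proof (rule transI)
    fix f g h :: "nat \<Rightarrow> 'a" assume "(f, g) \<in> ultra_rel U" "(g, h) \<in> ultra_rel U"
    then have "eventually (\<lambda>i. f i = g i) U" "eventually (\<lambda>i. g i = h i) U"
      by (simp_all add: ultra_rel_def)
    then have "eventually (\<lambda>i. f i = h i) U" by eventually_elim simp
    then show "(f, h) \<in> ultra_rel U" by (simp add: ultra_rel_def)
  qed
qed simp

lemma mem_ultra_class: "g \<in> ultra_class U f \<longleftrightarrow> eventually (\<lambda>i. f i = g i) U"
  by (simp add: ultra_class_def ultra_rel_def)

lemma ultrapower_eq: "ultrapower U = range (ultra_class U)"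
  by (auto simp: ultrapower_def quotient_def ultra_class_def)

lemma ultra_class_eq_iff: "ultra_class U f = ultra_class U g \<longleftrightarrow> eventually (\<lambda>i. f i = g i) U"
  unfolding ultra_class_def
  using eq_equiv_class_iff[OF equiv_ultra_rel, of f g] by (simp add: ultra_rel_def)

lemma ultra_map_class: "ultra_map U h (ultra_class U f) = ultra_class U (\<lambda>i. h (f i))"
proof (intro set_eqI iffI)
  fix k assume "k \<in> ultra_map U h (ultra_class U f)"
  then obtain f' where "eventually (\<lambda>i. f i = f' i) U" "eventually (\<lambda>i. k i = h (f' i)) U"
    by (auto simp: ultra_map_def mem_ultra_class)
  then show "k \<in> ultra_class U (\<lambda>i. h (f i))"
    unfolding mem_ultra_class by eventually_elim simp
next
  fix k assume "k \<in> ultra_class U (\<lambda>i. h (f i))"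
  then have "eventually (\<lambda>i. k i = h (f i)) U"
    unfolding mem_ultra_class by eventually_elim simp
  then show "k \<in> ultra_map U h (ultra_class U f)"
    by (auto simp: ultra_map_def mem_ultra_class intro!: bexI[of _ f])
qed

lemma ultra_map2_class:
  "ultra_map2 U h (ultra_class U f) (ultra_class U g) = ultra_class U (\<lambda>i. h (f i) (g i))"
proof (intro set_eqI iffI)
  fix k assume "k \<in> ultra_map2 U h (ultra_class U f) (ultra_class U g)"
  then obtain f' g' where "eventually (\<lambda>i. f i = f' i) U" "eventually (\<lambda>i. g i = g' i) U"
      "eventually (\<lambda>i. k i = h (f' i) (g' i)) U"
    by (auto simp: ultra_map2_def mem_ultra_class)
  then show "k \<in> ultra_class U (\<lambda>i. h (f i) (g i))"
    unfolding mem_ultra_class by eventually_elim simp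
next
  fix k assume "k \<in> ultra_class U (\<lambda>i. h (f i) (g i))"
  then have "eventually (\<lambda>i. k i = h (f i) (g i)) U"
    unfolding mem_ultra_class by eventually_elim simp
  then show "k \<in> ultra_map2 U h (ultra_class U f) (ultra_class U g)"
    by (auto simp: ultra_map2_def mem_ultra_class intro!: bexI[of _ f] bexI[of _ g])
qed

lemma ultra_lift2_class:
  "ultra_lift2 U R (ultra_class U f) (ultra_class U g) \<longleftrightarrow> eventually (\<lambda>i. R (f i) (g i)) U"
proof
  assume "ultra_lift2 U R (ultra_class U f) (ultra_class U g)"
  then obtain f' g' where "eventually (\<lambda>i. f i = f' i) U" "eventually (\<lambda>i. g i = g' i) U"
      "eventually (\<lambda>i. R (f' i) (g' i)) U"
    by (auto simp: ultra_lift2_def mem_ultra_class)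
  then show "eventually (\<lambda>i. R (f i) (g i)) U" by eventually_elim simp
next
  assume "eventually (\<lambda>i. R (f i) (g i)) U"
  then show "ultra_lift2 U R (ultra_class U f) (ultra_class U g)"
    by (auto simp: ultra_lift2_def mem_ultra_class intro!: bexI[of _ f] bexI[of _ g])
qed

lemmas ultra_simps = ultra_const_def ultra_map_class ultra_map2_class ultra_lift2_class
  ultra_class_eq_iff

definition hyperreals :: "nat filter \<Rightarrow> hyperreal set" where
  "hyperreals U = ultrapower U"

text \<open>The ultrapower of the integers, embedded in the ultrapower of the reals.\<close>

definition hyperints :: "nat filter \<Rightarrow> hyperreal set" where
  "hyperints U = ultra_map U real_of_int ` ultrapower U"

abbreviation h_zero :: "nat filter \<Rightarrow> hyperreal" where
  "h_zero U \<equiv> ultra_const U 0"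

abbreviation h_times :: "nat filter \<Rightarrow> hyperreal \<Rightarrow> hyperreal \<Rightarrow> hyperreal" where
  "h_times U \<equiv> ultra_map2 U (*)"

abbreviation h_minus :: "nat filter \<Rightarrow> hyperreal \<Rightarrow> hyperreal \<Rightarrow> hyperreal" where
  "h_minus U \<equiv> ultra_map2 U (-)"

abbreviation h_abs :: "nat filter \<Rightarrow> hyperreal \<Rightarrow> hyperreal" where
  "h_abs U \<equiv> ultra_map U abs"

abbreviation h_inverse :: "nat filter \<Rightarrow> hyperreal \<Rightarrow> hyperreal" where
  "h_inverse U \<equiv> ultra_map U inverse"

abbreviation h_less :: "nat filter \<Rightarrow> hyperreal \<Rightarrow> hyperreal \<Rightarrow> bool" where
  "h_less U \<equiv> ultra_lift2 U (<)"

abbreviation h_le :: "nat filter \<Rightarrow> hyperreal \<Rightarrow> hyperreal \<Rightarrow> bool" where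
  "h_le U \<equiv> ultra_lift2 U (\<le>)"

definition bounded_hyperreals :: "nat filter \<Rightarrow> hyperreal set" where
  "bounded_hyperreals U = {x \<in> hyperreals U. \<exists>r. h_le U (h_abs U x) (ultra_const U r)}"

definition infinitesimals :: "nat filter \<Rightarrow> hyperreal set" where
  "infinitesimals U = {x \<in> hyperreals U. \<forall>r>0. h_less U (h_abs U x) (ultra_const U r)}"

definition positive_bounded_units :: "nat filter \<Rightarrow> hyperreal set" where
  "positive_bounded_units U =
     {x \<in> bounded_hyperreals U. h_less U (h_zero U) x \<and> x \<notin> infinitesimals U}"

subsection \<open>Growth-decay classes\<close>

type_synonym gd_class = "hyperreal set"

definition nonneg_hyperreals :: "nat filter \<Rightarrow> hyperreal set" where
  "nonneg_hyperreals U = {x \<in> hyperreals U. h_less U (h_zero U) x} \<union> {h_zero U}"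

definition gd_rel :: "nat filter \<Rightarrow> (hyperreal \<times> hyperreal) set" where
  "gd_rel U = {(x, y). x \<in> nonneg_hyperreals U \<and> y \<in> nonneg_hyperreals U \<and>
                (\<exists>c\<in>positive_bounded_units U. y = h_times U c x)}"

definition gd_classes :: "nat filter \<Rightarrow> gd_class set" where
  "gd_classes U = nonneg_hyperreals U // gd_rel U"

definition gd :: "nat filter \<Rightarrow> hyperreal \<Rightarrow> gd_class" where
  "gd U x = gd_rel U `` {h_abs U x}"

definition gd_times :: "nat filter \<Rightarrow> gd_class \<Rightarrow> gd_class \<Rightarrow> gd_class" where
  "gd_times U \<mu> \<nu> = {h_times U x y | x y. x \<in> \<mu> \<and> y \<in> \<nu>}"

definition gd_inverse :: "nat filter \<Rightarrow> gd_class \<Rightarrow> gd_class" where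
  "gd_inverse U \<mu> = (THE \<nu>. \<nu> \<in> gd_classes U \<and> gd_times U \<mu> \<nu> = gd U (ultra_const U 1))"

definition gd_less :: "nat filter \<Rightarrow> gd_class \<Rightarrow> gd_class \<Rightarrow> bool" where
  "gd_less U \<mu> \<nu> \<longleftrightarrow> (\<forall>x\<in>\<mu>. \<forall>y\<in>\<nu>. h_less U x y)"

definition gd_le :: "nat filter \<Rightarrow> gd_class \<Rightarrow> gd_class \<Rightarrow> bool" where
  "gd_le U \<mu> \<nu> \<longleftrightarrow> gd_less U \<mu> \<nu> \<or> \<mu> = \<nu>"

definition gd_infinitesimal :: "nat filter \<Rightarrow> gd_class set" where
  "gd_infinitesimal U = gd U ` {x \<in> infinitesimals U. h_less U (h_zero U) x}"

lemma mem_positive_bounded_units: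
  assumes U: "nonprincipal_ultrafilter U"
  shows "x \<in> positive_bounded_units U \<longleftrightarrow>
    (\<exists>f a b. x = ultra_class U f \<and> 0 < a \<and> eventually (\<lambda>i. a \<le> f i \<and> f i \<le> b) U)"
proof
  assume x: "x \<in> positive_bounded_units U"
  then obtain f where f: "x = ultra_class U f"
    by (auto simp: positive_bounded_units_def bounded_hyperreals_def hyperreals_def ultrapower_eq)
  from x obtain b where b: "eventually (\<lambda>i. \<bar>f i\<bar> \<le> b) U" and pos: "eventually (\<lambda>i. 0 < f i) U"
    by (auto simp: positive_bounded_units_def bounded_hyperreals_def f ultra_simps)
  from x obtain a where a: "a > 0" "\<not> eventually (\<lambda>i. \<bar>f i\<bar> < a) U"
    by (auto simp: positive_bounded_units_def infinitesimals_def bounded_hyperreals_def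
        f ultra_simps)
  then have "eventually (\<lambda>i. \<not> \<bar>f i\<bar> < a) U"
    using U by (auto simp: nonprincipal_ultrafilter_def)
  with b pos have "eventually (\<lambda>i. a \<le> f i \<and> f i \<le> b) U"
    by eventually_elim auto
  with f a show "\<exists>f a b. x = ultra_class U f \<and> 0 < a \<and> eventually (\<lambda>i. a \<le> f i \<and> f i \<le> b) U"
    by blast
next
  assume "\<exists>f a b. x = ultra_class U f \<and> 0 < a \<and> eventually (\<lambda>i. a \<le> f i \<and> f i \<le> b) U"
  then obtain f a b where f: "x = ultra_class U f" and a: "0 < a"
    and ev: "eventually (\<lambda>i. a \<le> f i \<and> f i \<le> b) U" by blast
  have "eventually (\<lambda>i. \<bar>f i\<bar> \<le> b) U"
    using ev by eventually_elim (use a in auto)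
  moreover have "eventually (\<lambda>i. 0 < f i) U"
    using ev by eventually_elim (use a in auto)
  moreover have "\<not> eventually (\<lambda>i. \<bar>f i\<bar> < a) U"
  proof
    assume "eventually (\<lambda>i. \<bar>f i\<bar> < a) U"
    with ev have "eventually (\<lambda>i. False) U" by eventually_elim auto
    with U show False by (auto simp: nonprincipal_ultrafilter_def trivial_limit_def)
  qed
  ultimately show "x \<in> positive_bounded_units U"
    using a by (auto simp: positive_bounded_units_def bounded_hyperreals_def infinitesimals_def
        hyperreals_def ultrapower_eq f ultra_simps)
qed

lemma positive_class_mem_nonneg:
  "eventually (\<lambda>i. 0 < f i) U \<Longrightarrow> ultra_class U f \<in> nonneg_hyperreals U"
  by (auto simp: nonneg_hyperreals_def hyperreals_def ultrapower_eq ultra_const_def ultra_lift2_class)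

lemma mem_gd_pos:
  assumes U: "nonprincipal_ultrafilter U" and f: "eventually (\<lambda>i. 0 < f i) U"
  shows "y \<in> gd_rel U `` {ultra_class U f} \<longleftrightarrow>
    (\<exists>c a b. y = ultra_class U (\<lambda>i. c i * f i) \<and> 0 < a \<and> eventually (\<lambda>i. a \<le> c i \<and> c i \<le> b) U)"
proof
  assume "y \<in> gd_rel U `` {ultra_class U f}"
  then obtain c a b where "y = h_times U (ultra_class U c) (ultra_class U f)" "0 < a"
      "eventually (\<lambda>i. a \<le> c i \<and> c i \<le> b) U"
    by (auto simp: gd_rel_def mem_positive_bounded_units[OF U])
  then show "\<exists>c a b. y = ultra_class U (\<lambda>i. c i * f i) \<and> 0 < a \<and>
      eventually (\<lambda>i. a \<le> c i \<and> c i \<le> b) U"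
    unfolding ultra_map2_class by blast
next
  assume "\<exists>c a b. y = ultra_class U (\<lambda>i. c i * f i) \<and> 0 < a \<and>
      eventually (\<lambda>i. a \<le> c i \<and> c i \<le> b) U"
  then obtain c a b where y: "y = ultra_class U (\<lambda>i. c i * f i)" and a: "0 < a"
    and ev: "eventually (\<lambda>i. a \<le> c i \<and> c i \<le> b) U" by blast
  have "eventually (\<lambda>i. 0 < c i * f i) U"
    using ev f by eventually_elim (use a in auto)
  then have "y \<in> nonneg_hyperreals U" by (simp add: y positive_class_mem_nonneg)
  moreover have "ultra_class U c \<in> positive_bounded_units U"
    using a ev by (auto simp: mem_positive_bounded_units[OF U])
  moreover have "y = h_times U (ultra_class U c) (ultra_class U f)"
    by (simp add: y ultra_map2_class)
  ultimately show "y \<in> gd_rel U `` {ultra_class U f}"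
    using positive_class_mem_nonneg[OF f] by (auto simp: gd_rel_def)
qed

lemma gd_times_pos:
  assumes U: "nonprincipal_ultrafilter U"
    and f: "eventually (\<lambda>i. 0 < f i) U" and g: "eventually (\<lambda>i. 0 < g i) U"
  shows "gd_times U (gd_rel U `` {ultra_class U f}) (gd_rel U `` {ultra_class U g}) =
         gd_rel U `` {ultra_class U (\<lambda>i. f i * g i)}"
proof -
  have fg: "eventually (\<lambda>i. 0 < f i * g i) U"
    using f g by eventually_elim simp
  show ?thesis
  proof (intro set_eqI iffI)
    fix z assume "z \<in> gd_times U (gd_rel U `` {ultra_class U f}) (gd_rel U `` {ultra_class U g})"
    then obtain x y where z: "z = h_times U x y"
      and x: "x \<in> gd_rel U `` {ultra_class U f}" and y: "y \<in> gd_rel U `` {ultra_class U g}"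
      unfolding gd_times_def by blast
    obtain c a b where c: "x = ultra_class U (\<lambda>i. c i * f i)" "0 < a"
      "eventually (\<lambda>i. a \<le> c i \<and> c i \<le> b) U"
      using x unfolding mem_gd_pos[OF U f] by blast
    obtain c' a' b' where c': "y = ultra_class U (\<lambda>i. c' i * g i)" "0 < a'"
      "eventually (\<lambda>i. a' \<le> c' i \<and> c' i \<le> b') U"
      using y unfolding mem_gd_pos[OF U g] by blast
    have "z = ultra_class U (\<lambda>i. (c i * c' i) * (f i * g i))"
      unfolding z c(1) c'(1) ultra_map2_class by (simp add: mult_ac)
    moreover have "0 < a * a'" using c(2) c'(2) by simp
    moreover have "eventually (\<lambda>i. a * a' \<le> c i * c' i \<and> c i * c' i \<le> b * b') U"
      using c(3) c'(3) by eventually_elim (use c(2) c'(2) in \<open>auto intro!: mult_mono\<close>)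
    ultimately show "z \<in> gd_rel U `` {ultra_class U (\<lambda>i. f i * g i)}"
      unfolding mem_gd_pos[OF U fg]
      by (intro exI[of _ "\<lambda>i. c i * c' i"] exI[of _ "a * a'"] exI[of _ "b * b'"]) simp
  next
    fix z assume "z \<in> gd_rel U `` {ultra_class U (\<lambda>i. f i * g i)}"
    then obtain c a b where c: "z = ultra_class U (\<lambda>i. c i * (f i * g i))" "0 < a"
      "eventually (\<lambda>i. a \<le> c i \<and> c i \<le> b) U"
      unfolding mem_gd_pos[OF U fg] by blast
    have "z = h_times U (ultra_class U (\<lambda>i. c i * f i)) (ultra_class U g)"
      unfolding c(1) ultra_map2_class by (simp add: mult_ac)
    moreover have "ultra_class U (\<lambda>i. c i * f i) \<in> gd_rel U `` {ultra_class U f}"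
      unfolding mem_gd_pos[OF U f] using c(2,3) by blast
    moreover have "ultra_class U g \<in> gd_rel U `` {ultra_class U g}"
      unfolding mem_gd_pos[OF U g]
      by (intro exI[of _ "\<lambda>_. 1"] exI[of _ 1]) simp
    ultimately show "z \<in> gd_times U (gd_rel U `` {ultra_class U f}) (gd_rel U `` {ultra_class U g})"
      unfolding gd_times_def by blast
  qed
qed

lemma gd_pos_scale:
  assumes U: "nonprincipal_ultrafilter U" and f: "eventually (\<lambda>i. 0 < f i) U"
    and c: "0 < a" "eventually (\<lambda>i. a \<le> c i \<and> c i \<le> b) U"
  shows "gd_rel U `` {ultra_class U (\<lambda>i. c i * f i)} = gd_rel U `` {ultra_class U f}"
proof -
  have cf: "eventually (\<lambda>i. 0 < c i * f i) U"
    using c(2) f by eventually_elim (use c(1) in auto)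
  show ?thesis
  proof (intro set_eqI iffI)
    fix y assume "y \<in> gd_rel U `` {ultra_class U (\<lambda>i. c i * f i)}"
    then obtain d a' b' where d: "y = ultra_class U (\<lambda>i. d i * (c i * f i))" "0 < a'"
      "eventually (\<lambda>i. a' \<le> d i \<and> d i \<le> b') U"
      unfolding mem_gd_pos[OF U cf] by blast
    have "y = ultra_class U (\<lambda>i. (d i * c i) * f i)" unfolding d(1) by (simp add: mult_ac)
    moreover have "0 < a' * a" using c(1) d(2) by simp
    moreover have "eventually (\<lambda>i. a' * a \<le> d i * c i \<and> d i * c i \<le> b' * b) U"
      using c(2) d(3) by eventually_elim (use c(1) d(2) in \<open>auto intro!: mult_mono\<close>)
    ultimately show "y \<in> gd_rel U `` {ultra_class U f}"
      unfolding mem_gd_pos[OF U f]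
      by (intro exI[of _ "\<lambda>i. d i * c i"] exI[of _ "a' * a"] exI[of _ "b' * b"]) simp
  next
    fix y assume "y \<in> gd_rel U `` {ultra_class U f}"
    then obtain d a' b' where d: "y = ultra_class U (\<lambda>i. d i * f i)" "0 < a'"
      "eventually (\<lambda>i. a' \<le> d i \<and> d i \<le> b') U"
      unfolding mem_gd_pos[OF U f] by blast
    let ?B = "max b 1"
    have "y = ultra_class U (\<lambda>i. (d i / c i) * (c i * f i))"
      unfolding d(1) ultra_class_eq_iff using c(2) by eventually_elim (use c(1) in auto)
    moreover have "0 < a' / ?B" using d(2) by simp
    moreover have "eventually (\<lambda>i. a' / ?B \<le> d i / c i \<and> d i / c i \<le> b' / a) U"
      using c(2) d(3) by eventually_elim (use c(1) d(2) in \<open>auto intro!: frac_le\<close>)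
    ultimately show "y \<in> gd_rel U `` {ultra_class U (\<lambda>i. c i * f i)}"
      unfolding mem_gd_pos[OF U cf]
      by (intro exI[of _ "\<lambda>i. d i / c i"] exI[of _ "a' / ?B"] exI[of _ "b' / a"]) simp
  qed
qed

lemma gd_inverse_pos:
  assumes U: "nonprincipal_ultrafilter U" and f: "eventually (\<lambda>i. 0 < f i) U"
  shows "gd_inverse U (gd_rel U `` {ultra_class U f}) = gd_rel U `` {ultra_class U (\<lambda>i. inverse (f i))}"
  unfolding gd_inverse_def
proof (rule the_equality)
  have g: "eventually (\<lambda>i. 0 < inverse (f i)) U" using f by eventually_elim simp
  have 1: "gd U (ultra_const U 1) = gd_rel U `` {ultra_class U (\<lambda>_. 1)}"
    by (simp add: gd_def ultra_const_def ultra_map_class)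
  have "ultra_class U (\<lambda>i. f i * inverse (f i)) = ultra_class U (\<lambda>_. 1)"
    unfolding ultra_class_eq_iff using f by eventually_elim simp
  with positive_class_mem_nonneg[OF g] show
    "gd_rel U `` {ultra_class U (\<lambda>i. inverse (f i))} \<in> gd_classes U \<and>
     gd_times U (gd_rel U `` {ultra_class U f}) (gd_rel U `` {ultra_class U (\<lambda>i. inverse (f i))}) =
     gd U (ultra_const U 1)"
    by (simp add: 1 gd_times_pos[OF U f g] gd_classes_def quotientI)
  fix \<nu> assume \<nu>: "\<nu> \<in> gd_classes U \<and>
    gd_times U (gd_rel U `` {ultra_class U f}) \<nu> = gd U (ultra_const U 1)"
  then obtain x where x: "x \<in> nonneg_hyperreals U" "\<nu> = gd_rel U `` {x}"
    by (auto simp: gd_classes_def quotient_def)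
  then obtain h where h: "x = ultra_class U h"
    by (auto simp: nonneg_hyperreals_def hyperreals_def ultrapower_eq ultra_const_def)
  have one: "ultra_class U (\<lambda>_. 1) \<in> gd U (ultra_const U 1)"
    unfolding 1 by (subst mem_gd_pos[OF U]) (auto intro!: exI[of _ "\<lambda>_. 1"] exI[of _ "1::real"])
  from one \<nu> obtain y z where yz: "z \<in> \<nu>" "ultra_class U (\<lambda>_. 1) = h_times U y z"
    "y \<in> gd_rel U `` {ultra_class U f}"
    unfolding gd_times_def by blast
  obtain d a b where d: "y = ultra_class U (\<lambda>i. d i * f i)" "0 < a"
      "eventually (\<lambda>i. a \<le> d i \<and> d i \<le> b) U"
    using yz(3) unfolding mem_gd_pos[OF U f] by blast
  obtain e where e: "z = ultra_class U (\<lambda>i. e i * h i)"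
    and e': "ultra_class U e \<in> positive_bounded_units U"
    using yz(1) unfolding x h gd_rel_def
    by (auto simp: positive_bounded_units_def bounded_hyperreals_def hyperreals_def
        ultrapower_eq ultra_map2_class)
  have prod: "eventually (\<lambda>i. 1 = d i * f i * (e i * h i)) U"
    using yz(2) unfolding d e ultra_map2_class ultra_class_eq_iff .
  have "\<not> eventually (\<lambda>i. h i = 0) U"
  proof
    assume "eventually (\<lambda>i. h i = 0) U"
    with prod have "eventually (\<lambda>i. False) U" by eventually_elim auto
    with U show False by (auto simp: nonprincipal_ultrafilter_def trivial_limit_def)
  qed
  with x(1) have hp: "eventually (\<lambda>i. 0 < h i) U"
    by (auto simp: h nonneg_hyperreals_def ultra_simps)
  have fh: "eventually (\<lambda>i. 0 < f i * h i) U" using f hp by eventually_elim simp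
  have "gd_rel U `` {ultra_class U (\<lambda>i. f i * h i)} = gd_rel U `` {ultra_class U (\<lambda>_. 1)}"
    using \<nu> unfolding x h gd_times_pos[OF U f hp] 1 by simp
  then have "ultra_class U (\<lambda>_. 1) \<in> gd_rel U `` {ultra_class U (\<lambda>i. f i * h i)}"
    using one 1 by simp
  then obtain c a b where c: "ultra_class U (\<lambda>_. 1) = ultra_class U (\<lambda>i. c i * (f i * h i))"
    "0 < a" "eventually (\<lambda>i. a \<le> c i \<and> c i \<le> b) U"
    unfolding mem_gd_pos[OF U fh] by blast
  have "eventually (\<lambda>i. 1 = c i * (f i * h i)) U"
    using c(1) unfolding ultra_class_eq_iff .
  then have "eventually (\<lambda>i. inverse (f i) = c i * h i) U"
    using f by eventually_elim (simp add: field_simps)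
  then have "ultra_class U (\<lambda>i. inverse (f i)) = ultra_class U (\<lambda>i. c i * h i)"
    unfolding ultra_class_eq_iff .
  then show "\<nu> = gd_rel U `` {ultra_class U (\<lambda>i. inverse (f i))}"
    using gd_pos_scale[OF U hp c(2,3)] by (simp add: x h)
qed

subsection \<open>Diophantine approximation groups\<close>

definition growth :: "nat filter \<Rightarrow> hyperreal \<Rightarrow> gd_class" where
  "growth U n = gd_inverse U (gd U n)"

definition approx_group :: "nat filter \<Rightarrow> real \<Rightarrow> hyperreal set" where
  "approx_group U \<theta> = {n \<in> hyperints U. \<exists>m\<in>hyperints U.
     h_minus U (h_times U n (ultra_const U \<theta>)) m \<in> infinitesimals U}"

definition dual :: "nat filter \<Rightarrow> real \<Rightarrow> hyperreal \<Rightarrow> hyperreal" where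
  "dual U \<theta> n = (THE m. m \<in> hyperints U \<and>
     h_minus U (h_times U n (ultra_const U \<theta>)) m \<in> infinitesimals U)"

definition error_term :: "nat filter \<Rightarrow> real \<Rightarrow> hyperreal \<Rightarrow> hyperreal" where
  "error_term U \<theta> n = h_minus U (h_times U n (ultra_const U \<theta>)) (dual U \<theta> n)"

definition decay :: "nat filter \<Rightarrow> real \<Rightarrow> hyperreal \<Rightarrow> gd_class" where
  "decay U \<theta> n = gd U (error_term U \<theta> n)"

lemma dual_unique:
  assumes m: "m \<in> hyperints U" "h_minus U (h_times U n (ultra_const U \<theta>)) m \<in> infinitesimals U"
    and m': "m' \<in> hyperints U" "h_minus U (h_times U n (ultra_const U \<theta>)) m' \<in> infinitesimals U"
    and n: "n \<in> hyperints U"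
  shows "m = m'"
proof -
  obtain f g g' :: "nat \<Rightarrow> int" where
    n': "n = ultra_class U (\<lambda>i. real_of_int (f i))" and
    g: "m = ultra_class U (\<lambda>i. real_of_int (g i))" and
    g': "m' = ultra_class U (\<lambda>i. real_of_int (g' i))"
    using m(1) m'(1) n by (auto simp: hyperints_def ultrapower_eq ultra_map_class)
  have "eventually (\<lambda>i. \<bar>real_of_int (f i) * \<theta> - real_of_int (g i)\<bar> < 1/2) U"
       "eventually (\<lambda>i. \<bar>real_of_int (f i) * \<theta> - real_of_int (g' i)\<bar> < 1/2) U"
    using m(2) m'(2) unfolding n' g g' infinitesimals_def
    by (auto simp: ultra_simps dest!: spec[of _ "1/2 :: real"])
  then have "eventually (\<lambda>i. real_of_int (g i) = real_of_int (g' i)) U"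
  proof eventually_elim
    case (elim i)
    then have "real_of_int (g i) - real_of_int (g' i) < 1" "real_of_int (g' i) - real_of_int (g i) < 1"
      by (simp_all only: abs_less_iff) linarith+
    then have "g i - g' i < 1" "g' i - g i < 1" by linarith+
    then show ?case by simp
  qed
  then show ?thesis by (simp add: g g' ultra_class_eq_iff)
qed

definition gd_approx_group ::
    "nat filter \<Rightarrow> gd_class \<Rightarrow> gd_class \<Rightarrow> real \<Rightarrow> hyperreal set" where
  "gd_approx_group U \<mu> \<nu> \<theta> =
     {n \<in> approx_group U \<theta>. n \<noteq> h_zero U \<and>
        gd_less U \<mu> (growth U n) \<and> gd_le U (decay U \<theta> n) \<nu>} \<union> {h_zero U}"

subsection \<open>Classes of real numbers\<close>

definition int_dist :: "real \<Rightarrow> real" where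
  "int_dist x = \<bar>x - of_int (round x)\<bar>"

definition well_approximable :: "real set" where
  "well_approximable =
     {\<theta>. \<theta> \<notin> \<rat> \<and> liminf (\<lambda>n. ereal (real n * int_dist (real n * \<theta>))) = 0}"

definition kappa_approximable_real :: "real \<Rightarrow> real set" where
  "kappa_approximable_real \<kappa> =
     {\<theta>. \<theta> \<notin> \<rat> \<and> infinite {n::nat. int_dist (real n * \<theta>) < real n powr (- \<kappa>)}}"

definition liouville_numbers :: "real set" where
  "liouville_numbers = (\<Inter>\<kappa>\<in>{1<..}. kappa_approximable_real \<kappa>)"

definition kappa_approximable :: "ereal \<Rightarrow> real set" where
  "kappa_approximable \<kappa> =
     (if \<kappa> = \<infinity> then liouville_numbers else kappa_approximable_real (real_of_ereal \<kappa>))"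

primrec complete_quotient :: "real \<Rightarrow> nat \<Rightarrow> real" where
  "complete_quotient \<theta> 0 = \<theta>"
| "complete_quotient \<theta> (Suc n) = 1 / frac (complete_quotient \<theta> n)"

definition partial_quotient :: "real \<Rightarrow> nat \<Rightarrow> int" where
  "partial_quotient \<theta> n = \<lfloor>complete_quotient \<theta> n\<rfloor>"

text \<open>Blocks are disjoint as blocks of positions in the expansion; the values occurring
  in different blocks may coincide.\<close>

definition abyssal :: "real \<Rightarrow> bool" where
  "abyssal \<theta> \<longleftrightarrow> \<theta> \<notin> \<rat> \<and>
     (\<exists>(i :: nat \<Rightarrow> nat) (k :: nat \<Rightarrow> nat) C.
        disjoint_family (\<lambda>n. {i n .. i n + k n}) \<and>
        (\<forall>n. \<forall>j\<in>{i n .. i n + k n}. partial_quotient \<theta> j \<le> C) \<and>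
        filterlim k at_top sequentially)"

end

theory Submission
  imports Defs
begin

text \<open>If \<open>\<langle>t\<rangle>\<^bsup>-1\<^esup> = \<mu>\<close>, then \<open>{}^*\<int>\<^sup>\<mu>\<^sub>\<mu>(\<theta>)\<close> is nonzero only if some \<open>n\<close> satisfies \<open>n \<lless> t\<close> and
  \<open>t * \<parallel>n * \<theta>\<parallel> \<le> C\<close>, which forces \<open>q\<^sub>k \<lless> t \<le> 2 * C * q\<^sub>k\<^sub>+\<^sub>1\<close> for consecutive convergent denominators
  of \<open>\<theta>\<close>; in particular the partial quotient \<open>a\<^sub>k\<^sub>+\<^sub>1\<close> is large. We therefore take two numbers whose
  partial quotients are 2 except at rare, enormous jumps, where the intervals \<open>[q\<^sub>k, q\<^sub>k\<^sub>+\<^sub>1]\<close> spanned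
  by the jumps of one number are disjoint from those of the other. Jumps to beyond the \<open>k\<close>-th power of
  \<open>q\<^sub>k\<close> make both numbers Liouville, so a single pair serves all exponents \<open>\<kappa>, \<kappa>'\<close>.\<close>

section \<open>Continued fractions with prescribed partial quotients\<close>

fun cf_den :: "(nat \<Rightarrow> nat) \<Rightarrow> nat \<Rightarrow> nat" where
  "cf_den a 0 = 1"
| "cf_den a (Suc 0) = a 1"
| "cf_den a (Suc (Suc n)) = a (Suc (Suc n)) * cf_den a (Suc n) + cf_den a n"

fun cf_num :: "(nat \<Rightarrow> nat) \<Rightarrow> nat \<Rightarrow> nat" where
  "cf_num a 0 = a 0"
| "cf_num a (Suc 0) = a 1 * a 0 + 1"
| "cf_num a (Suc (Suc n)) = a (Suc (Suc n)) * cf_num a (Suc n) + cf_num a n"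

text \<open>The finite continued fraction [a k; a (k+1), ..., a (k+n)]. The starting index is an
  argument so that inductions on the length can pass to the shifted sequence.\<close>

primrec cf_approx :: "(nat \<Rightarrow> nat) \<Rightarrow> nat \<Rightarrow> nat \<Rightarrow> real" where
  "cf_approx a 0 k = real (a k)"
| "cf_approx a (Suc n) k = real (a k) + 1 / cf_approx a n (Suc k)"

definition cf_tail :: "(nat \<Rightarrow> nat) \<Rightarrow> nat \<Rightarrow> real" where
  "cf_tail a k = lim (\<lambda>n. cf_approx a n k)"

definition cf_value :: "(nat \<Rightarrow> nat) \<Rightarrow> real" where
  "cf_value a = cf_tail a 0"

lemma cf_num_den_det:
  "int (cf_den a n) * int (cf_num a (Suc n)) - int (cf_den a (Suc n)) * int (cf_num a n) = (-1) ^ n"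
  by (induction n) (simp_all add: algebra_simps)

text \<open>Two consecutive convergents have determinant 1 or -1, and any common divisor divides
  it.\<close>

lemma coprime_cf_num_den: "coprime (int (cf_num a n)) (int (cf_den a n))"
proof (rule coprimeI)
  fix d assume "d dvd int (cf_num a n)" "d dvd int (cf_den a n)"
  then have "d dvd int (cf_den a n) * int (cf_num a (Suc n)) - int (cf_den a (Suc n)) * int (cf_num a n)"
    by simp
  then show "is_unit d"
    unfolding cf_num_den_det by (simp add: dvd_power_iff minus_one_power_iff split: if_splits)
qed

text \<open>Requiring all partial quotients to be at least 2 makes the Gauss inverse branches
  uniform contractions, so that the finite continued fractions converge geometrically.\<close>

locale continued_fraction =
  fixes a :: "nat \<Rightarrow> nat"
  assumes quotient_ge_2: "\<And>n. a n \<ge> 2"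
begin

section \<open>Convergence of the finite continued fractions and the complete quotients of the
  limit\<close>

lemma cf_approx_ge_2: "cf_approx a n k \<ge> 2"
proof -
  have *: "real (a k) \<ge> 2" for k using quotient_ge_2[of k] by linarith
  show ?thesis
  proof (induction n arbitrary: k)
    case (Suc n)
    have "1 / cf_approx a n (Suc k) \<ge> 0" using Suc[of "Suc k"] by simp
    then show ?case using *[of k] unfolding cf_approx.simps by linarith
  qed (use * in simp)
qed

lemma cf_approx_step: "\<bar>cf_approx a (Suc n) k - cf_approx a n k\<bar> \<le> (1/4) ^ n"
proof (induction n arbitrary: k)
  case 0
  show ?case using cf_approx_ge_2[of 0 "Suc k"] by simp
next
  case (Suc n)
  let ?x = "cf_approx a (Suc n) (Suc k)" and ?y = "cf_approx a n (Suc k)"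
  have xy: "?x \<ge> 2" "?y \<ge> 2" by (rule cf_approx_ge_2)+
  then have "?x * ?y \<ge> 2 * 2" by (intro mult_mono) auto
  have "cf_approx a (Suc (Suc n)) k - cf_approx a (Suc n) k = 1 / ?x - 1 / ?y"
    by simp
  also have "\<dots> = (?y - ?x) / (?x * ?y)" using xy by (intro diff_frac_eq[THEN trans]) auto
  finally have "\<bar>cf_approx a (Suc (Suc n)) k - cf_approx a (Suc n) k\<bar> = \<bar>?x - ?y\<bar> / (?x * ?y)"
    using \<open>?x * ?y \<ge> 2 * 2\<close> by (simp only: abs_divide abs_minus_commute)
  also have "\<dots> \<le> (1/4) ^ n / 4"
    using Suc.IH[of "Suc k"] \<open>?x * ?y \<ge> 2 * 2\<close> by (intro frac_le) auto
  finally show ?case by simp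
qed

lemma cf_approx_tendsto: "(\<lambda>n. cf_approx a n k) \<longlonglongrightarrow> cf_tail a k"
proof -
  have "summable (\<lambda>n. cf_approx a (Suc n) k - cf_approx a n k)"
    by (rule summable_comparison_test'[where g = "\<lambda>n. (1/4) ^ n" and N = 0])
      (use cf_approx_step in auto)
  then have "convergent (\<lambda>n. cf_approx a n k)"
    by (simp add: summable_iff_convergent sum_lessThan_telescope[of "\<lambda>n. cf_approx a n k"]
        convergent_diff_const_right_iff del: cf_approx.simps)
  then show ?thesis unfolding cf_tail_def by (simp add: convergent_LIMSEQ_iff)
qed

lemma cf_tail_ge_2: "cf_tail a k \<ge> 2"
  using cf_approx_tendsto by (rule LIMSEQ_le_const) (use cf_approx_ge_2 in auto)

lemma cf_tail_rec: "cf_tail a k = real (a k) + 1 / cf_tail a (Suc k)"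
proof (rule LIMSEQ_unique)
  show "(\<lambda>n. cf_approx a (Suc n) k) \<longlonglongrightarrow> cf_tail a k"
    using cf_approx_tendsto by (rule LIMSEQ_Suc)
  show "(\<lambda>n. cf_approx a (Suc n) k) \<longlonglongrightarrow> real (a k) + 1 / cf_tail a (Suc k)"
    unfolding cf_approx.simps using cf_tail_ge_2[of "Suc k"]
    by (intro tendsto_intros cf_approx_tendsto) auto
qed

lemma floor_cf_tail: "\<lfloor>cf_tail a k\<rfloor> = int (a k)"
proof -
  have "0 < 1 / cf_tail a (Suc k)" "1 / cf_tail a (Suc k) < 1"
    using cf_tail_ge_2[of "Suc k"] by auto
  then show ?thesis by (subst cf_tail_rec, intro floor_unique) auto
qed

lemma complete_quotient_cf_value: "complete_quotient (cf_value a) k = cf_tail a k"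
proof (induction k)
  case (Suc k)
  have "frac (cf_tail a k) = 1 / cf_tail a (Suc k)"
    unfolding frac_def floor_cf_tail by (subst cf_tail_rec) simp
  then show ?case using Suc by simp
qed (simp add: cf_value_def)

lemma partial_quotient_cf_value: "partial_quotient (cf_value a) k = int (a k)"
  by (simp add: partial_quotient_def complete_quotient_cf_value floor_cf_tail)

section \<open>Growth of the convergent denominators\<close>

lemma cf_den_pos: "cf_den a n > 0"
proof -
  have "cf_den a n > 0 \<and> cf_den a (Suc n) > 0"
    by (induction n) (use quotient_ge_2[of 1] in auto)
  then show ?thesis ..
qed

lemma cf_den_step: "a (Suc n) * cf_den a n \<le> cf_den a (Suc n)"
  by (cases n) simp_all

lemma cf_den_double: "2 * cf_den a n \<le> cf_den a (Suc n)"
proof -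
  have "2 * cf_den a n \<le> a (Suc n) * cf_den a n" using quotient_ge_2 by simp
  then show ?thesis using cf_den_step[of n] by linarith
qed

lemma cf_den_step_le: "cf_den a (Suc n) \<le> (a (Suc n) + 1) * cf_den a n"
proof (cases n)
  case (Suc m)
  then show ?thesis using cf_den_double[of m] by (simp add: algebra_simps)
qed simp

lemma strict_mono_cf_den: "strict_mono (cf_den a)"
  by (rule strict_mono_Suc_iff[THEN iffD2]) (use cf_den_double cf_den_pos in \<open>metis less_le_trans mult_2 less_add_same_cancel1\<close>)

lemma cf_den_ge_power: "2 ^ n \<le> cf_den a n"
proof (induction n)
  case (Suc n) then show ?case using cf_den_double[of n] by simp
qed simp

section \<open>Approximation errors of the convergents\<close>

definition cf_err :: "nat \<Rightarrow> real" where
  "cf_err n = real (cf_den a n) * cf_value a - real (cf_num a n)"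

text \<open>The three-term recurrence of the errors and the rule x = a + 1/y for complete quotients
  propagate this relation. It shows that the errors alternate in sign.\<close>

lemma cf_err_Suc: "cf_err n = - cf_tail a (Suc (Suc n)) * cf_err (Suc n)"
proof (induction n)
  case 0
  define x y where "x = cf_tail a 1" and "y = cf_tail a 2"
  have xy: "x > 0" "y > 0" unfolding x_def y_def using cf_tail_ge_2[of 1] cf_tail_ge_2[of 2] by auto
  have v: "cf_value a = real (a 0) + 1 / x" and x: "x = real (a 1) + 1 / y"
    unfolding cf_value_def x_def y_def numeral_2_eq_2 using cf_tail_rec[of 0] cf_tail_rec[of 1] by simp_all
  have e0: "cf_err 0 = 1 / x" by (simp add: cf_err_def v)
  have "cf_err 1 = real (a 1) / x - 1"
    by (simp add: cf_err_def v algebra_simps)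
  also have "\<dots> = (real (a 1) - x) / x" using xy by (simp add: diff_divide_distrib)
  also have "\<dots> = - (1 / y) / x" by (subst (1) x) simp
  finally show ?case using e0 xy by (simp add: y_def numeral_2_eq_2)
next
  case (Suc n)
  define x y where "x = cf_tail a (Suc (Suc n))" and "y = cf_tail a (Suc (Suc (Suc n)))"
  have y: "y > 0" unfolding y_def using cf_tail_ge_2[of "Suc (Suc (Suc n))"] by simp
  have x: "x = real (a (Suc (Suc n))) + 1 / y" unfolding x_def y_def by (rule cf_tail_rec)
  have "cf_err (Suc (Suc n)) = real (a (Suc (Suc n))) * cf_err (Suc n) + cf_err n"
    by (simp add: cf_err_def algebra_simps)
  also have "\<dots> = - cf_err (Suc n) / y" using Suc x y by (simp add: x_def[symmetric] field_simps)
  finally show ?case using y by (simp add: y_def)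
qed

text \<open>As consecutive errors have opposite signs, this is the determinant identity rewritten
  with absolute errors. Dropping the second summand gives \<open>cf_err_le\<close>.\<close>

lemma cf_err_identity:
  "real (cf_den a (Suc n)) * \<bar>cf_err n\<bar> + real (cf_den a n) * \<bar>cf_err (Suc n)\<bar> = 1"
proof -
  \<comment> \<open>No cancellation occurs in the recurrence, because \<open>cf_err (Suc n)\<close>
    and \<open>cf_err (Suc (Suc n))\<close> have opposite signs.\<close>
  have abs_rec: "\<bar>cf_err n\<bar> = real (a (Suc (Suc n))) * \<bar>cf_err (Suc n)\<bar> + \<bar>cf_err (Suc (Suc n))\<bar>" for n
  proof -
    define y where "y = cf_tail a (Suc (Suc (Suc n)))"
    have y: "y > 0" unfolding y_def using cf_tail_ge_2[of "Suc (Suc (Suc n))"] by simp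
    have "\<bar>cf_err n\<bar> = cf_tail a (Suc (Suc n)) * \<bar>cf_err (Suc n)\<bar>"
      using cf_tail_ge_2[of "Suc (Suc n)"] by (subst cf_err_Suc) (simp add: abs_mult)
    also have "\<dots> = (real (a (Suc (Suc n))) + 1 / y) * \<bar>cf_err (Suc n)\<bar>"
      unfolding y_def by (subst cf_tail_rec) simp
    also have "\<bar>cf_err (Suc n)\<bar> = y * \<bar>cf_err (Suc (Suc n))\<bar>"
      using y by (subst cf_err_Suc) (simp add: abs_mult y_def)
    finally show ?thesis using y cf_err_Suc[of "Suc n"] by (simp add: field_simps abs_mult y_def)
  qed
  show ?thesis
  proof (induction n)
    case 0
    define x where "x = cf_tail a 1"
    have x: "x \<ge> 2" unfolding x_def by (rule cf_tail_ge_2)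
    have e0: "cf_err 0 = 1 / x" by (simp add: cf_err_def cf_value_def cf_tail_rec[of 0] x_def)
    have "\<bar>cf_err 1\<bar> = \<bar>real (a 1) / x - 1\<bar>"
      by (simp add: cf_err_def cf_value_def cf_tail_rec[of 0] x_def algebra_simps)
    moreover have "real (a 1) \<le> x"
      unfolding x_def using cf_tail_rec[of 1] cf_tail_ge_2[of "Suc 1"] by simp
    ultimately have "\<bar>cf_err 1\<bar> = 1 - real (a 1) / x" using x by simp
    then show ?case using e0 x by simp
  next
    case (Suc n)
    then show ?case by (simp add: abs_rec[of n] algebra_simps)
  qed
qed

lemma cf_err_le: "\<bar>cf_err n\<bar> \<le> 1 / real (cf_den a (Suc n))"
proof -
  have "real (cf_den a (Suc n)) * \<bar>cf_err n\<bar> \<le> 1"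
    using cf_err_identity[of n] by (smt (verit) abs_ge_zero mult_nonneg_nonneg of_nat_0_le_iff)
  then show ?thesis using cf_den_pos[of "Suc n"] by (simp add: field_simps)
qed

text \<open>Let p/q be the k-th convergent. Coprimality makes n p - m q a nonzero integer. It
  differs from q (n \<theta> - m) by n times \<open>cf_err k\<close>, which is at most 1/2 in
  absolute value because the denominators at least double.\<close>

lemma cf_value_approx_lower:
  fixes n m :: int
  assumes n: "n \<noteq> 0" "\<bar>n\<bar> < int (cf_den a k)"
  shows "1 \<le> 2 * real (cf_den a k) * \<bar>of_int n * cf_value a - of_int m\<bar>"
proof -
  let ?p = "int (cf_num a k)" and ?q = "int (cf_den a k)"
  have "n * ?p - m * ?q \<noteq> 0"
  proof
    assume "n * ?p - m * ?q = 0"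
    then have "?q dvd n * ?p" by simp
    then have "?q dvd n"
      using coprime_cf_num_den[of a k] by (simp add: coprime_dvd_mult_left_iff coprime_commute)
    then show False using n dvd_imp_le_int[of n ?q] by auto
  qed
  then have "1 \<le> \<bar>n * ?p - m * ?q\<bar>" by linarith
  then have "1 \<le> \<bar>of_int (n * ?p - m * ?q) :: real\<bar>" by linarith
  also have "of_int (n * ?p - m * ?q) =
      real (cf_den a k) * (of_int n * cf_value a - of_int m) - of_int n * cf_err k"
    by (simp add: cf_err_def algebra_simps)
  also have "\<bar>\<dots>\<bar> \<le> real (cf_den a k) * \<bar>of_int n * cf_value a - of_int m\<bar> + \<bar>of_int n\<bar> * \<bar>cf_err k\<bar>"
    by (rule order_trans[OF abs_triangle_ineq4]) (simp add: abs_mult)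
  also have "\<bar>of_int n\<bar> * \<bar>cf_err k\<bar> \<le> 1 / 2"
  proof -
    have "\<bar>of_int n :: real\<bar> \<le> real (cf_den a k)" using n by linarith
    then have "\<bar>of_int n\<bar> * \<bar>cf_err k\<bar> \<le> real (cf_den a k) * (1 / real (cf_den a (Suc k)))"
      using cf_err_le by (intro mult_mono) auto
    also have "\<dots> \<le> 1 / 2"
      using cf_den_double[of k] cf_den_pos[of "Suc k"] by (simp add: field_simps flip: of_nat_mult of_nat_le_iff)
    finally show ?thesis .
  qed
  finally show ?thesis by simp
qed

lemma cf_den_exceeds: "\<exists>k. n < cf_den a k"
  using cf_den_ge_power less_exp less_le_trans by blast

lemma cf_value_irrational: "cf_value a \<notin> \<rat>"
proof
  assume "cf_value a \<in> \<rat>"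
  then obtain m n :: int where n: "n > 0" and v: "cf_value a = of_int m / of_int n"
    by (metis Rats_cases')
  obtain k where "nat n < cf_den a k" using cf_den_exceeds by blast
  then have "\<bar>n\<bar> < int (cf_den a k)" using n by linarith
  from cf_value_approx_lower[OF _ this, of m] n v show False by simp
qed

text \<open>Choose k with q_k <= |n| < q_(k+1); the lower bound for |n \<theta> - m| yields t <= 2 C
  q_(k+1). The constant 6 is 2 * 3: a quotient of at most 2 would give q_(k+1) <= 3 q_k, hence t <=
  6 C q_k < t.\<close>

lemma cf_value_approx_imp_large_quotient:
  fixes n m :: int and t C :: real
  assumes n: "n \<noteq> 0" and C: "C > 0"
    and nt: "6 * C * \<bar>of_int n\<bar> < t" and err: "t * \<bar>of_int n * cf_value a - of_int m\<bar> \<le> C"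
  obtains k where "a (Suc k) > 2" "6 * C * real (cf_den a k) < t" "t \<le> 2 * C * real (cf_den a (Suc k))"
proof -
  define K where "K = (LEAST k. nat \<bar>n\<bar> < cf_den a k)"
  have K: "nat \<bar>n\<bar> < cf_den a K" unfolding K_def using cf_den_exceeds by (rule LeastI_ex)
  \<comment> \<open>\<open>cf_den a 0 = 1\<close> does not exceed |n|, so K has a
    predecessor.\<close>
  moreover have "nat \<bar>n\<bar> \<ge> 1" using n by linarith
  ultimately have "K \<noteq> 0" by (intro notI) simp
  then obtain k where k: "K = Suc k" using not0_implies_Suc by blast
  have t: "t > 0" using nt C by (smt (verit) mult_nonneg_nonneg)
  have "cf_den a k \<le> nat \<bar>n\<bar>"
    using not_less_Least[of k "\<lambda>k. nat \<bar>n\<bar> < cf_den a k"] k unfolding K_def by simp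
  then have "real (cf_den a k) \<le> \<bar>of_int n\<bar>" by linarith
  then have "6 * C * real (cf_den a k) \<le> 6 * C * \<bar>of_int n\<bar>" using C by (intro mult_left_mono) auto
  with nt have low: "6 * C * real (cf_den a k) < t" by simp
  have "\<bar>n\<bar> < int (cf_den a K)" using K by linarith
  from cf_value_approx_lower[OF n this, of m]
  have "t * 1 \<le> t * (2 * real (cf_den a K) * \<bar>of_int n * cf_value a - of_int m\<bar>)"
    using t by (intro mult_left_mono) auto
  also have "\<dots> = 2 * real (cf_den a K) * (t * \<bar>of_int n * cf_value a - of_int m\<bar>)" by simp
  also have "\<dots> \<le> 2 * real (cf_den a K) * C" using err by (intro mult_left_mono) auto
  finally have up: "t \<le> 2 * C * real (cf_den a (Suc k))" by (simp add: k mult_ac)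
  have "a (Suc k) > 2"
  proof (rule ccontr)
    assume "\<not> a (Suc k) > 2"
    then have "a (Suc k) + 1 \<le> 3" by simp
    then have "cf_den a (Suc k) \<le> 3 * cf_den a k"
      using cf_den_step_le[of k] by (meson le_trans mult_le_mono1)
    then have "2 * C * real (cf_den a (Suc k)) \<le> 2 * C * (3 * real (cf_den a k))"
      using C by (intro mult_left_mono) linarith+
    with low up show False by simp
  qed
  from that[OF this low up] show thesis .
qed

end

section \<open>Approximation classes\<close>

lemma int_dist_le: "int_dist x \<le> \<bar>x - of_int m\<bar>"
  unfolding int_dist_def by (rule round_diff_minimal)

lemma int_dist_nonneg: "int_dist x \<ge> 0"
  by (simp add: int_dist_def)

lemma liouville_subset_kappa_approximable:
  assumes "\<theta> \<in> liouville_numbers" "1 \<le> \<kappa>"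
  shows "\<theta> \<in> kappa_approximable_real \<kappa>"
proof -
  \<comment> \<open>\<open>liouville_numbers\<close> only intersects over exponents above 1, so
    \<kappa> = 1 has to be reached from a larger exponent.\<close>
  have \<theta>: "\<theta> \<in> kappa_approximable_real (\<kappa> + 1)"
    using assms by (auto simp: liouville_numbers_def)
  have "{n. int_dist (real n * \<theta>) < real n powr (- (\<kappa> + 1))} \<subseteq>
        {n. int_dist (real n * \<theta>) < real n powr (- \<kappa>)}"
  proof clarify
    fix n assume n: "int_dist (real n * \<theta>) < real n powr (- (\<kappa> + 1))"
    \<comment> \<open>At n = 0 both sides are 0, since \<open>0 powr x = 0\<close>, and the strict
      inequality fails.\<close>
    then have "n \<noteq> 0" by (intro notI) (simp add: int_dist_def)
    then have "real n powr (- (\<kappa> + 1)) \<le> real n powr (- \<kappa>)" by (intro powr_mono) auto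
    with n show "int_dist (real n * \<theta>) < real n powr (- \<kappa>)" by simp
  qed
  with \<theta> show ?thesis
    unfolding kappa_approximable_real_def using finite_subset by blast
qed

lemma liouville_kappa_approximable:
  assumes "\<theta> \<in> liouville_numbers" "\<kappa> \<in> {1..\<infinity>}"
  shows "\<theta> \<in> kappa_approximable \<kappa>"
  using assms liouville_subset_kappa_approximable
  by (cases \<kappa>) (auto simp: kappa_approximable_def one_ereal_def)

lemma liouville_well_approximable:
  assumes "\<theta> \<in> liouville_numbers"
  shows "\<theta> \<in> well_approximable"
proof -
  let ?f = "\<lambda>n. ereal (real n * int_dist (real n * \<theta>))"
  have "\<theta> \<in> kappa_approximable_real 2"
    using assms by (auto simp: liouville_numbers_def)
  then have irr: "\<theta> \<notin> \<rat>" and inf: "infinite {n. int_dist (real n * \<theta>) < real n powr (- 2)}"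
    by (auto simp: kappa_approximable_real_def)
  have "liminf ?f \<le> 0"
  proof (rule ccontr)
    assume "\<not> liminf ?f \<le> 0"
    then obtain e where e: "0 < ereal e" "ereal e < liminf ?f"
      using ereal_dense2[of 0 "liminf ?f"] by (auto simp: not_le)
    then have "eventually (\<lambda>n. ereal e < ?f n) sequentially"
      by (intro less_LiminfD)
    then obtain M where M: "\<And>n. n \<ge> M \<Longrightarrow> e < real n * int_dist (real n * \<theta>)"
      by (auto simp: eventually_sequentially)
    obtain K :: nat where K: "1 / e < real K" using reals_Archimedean2 by blast
    obtain n where n: "n > max M (max K 1)" "int_dist (real n * \<theta>) < real n powr (- 2)"
      using inf unfolding infinite_nat_iff_unbounded by blast
    have n0: "real n > 0" using n by simp
    have "e < real n * int_dist (real n * \<theta>)" using n M by simp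
    also have "\<dots> \<le> real n * real n powr (- 2)"
      using n by (intro mult_left_mono) auto
    also have "\<dots> = 1 / real n"
      using n0 by (simp add: powr_minus powr_numeral field_simps power2_eq_square)
    finally have "real n < 1 / e" using e n0 by (simp add: field_simps)
    with K n show False by simp
  qed
  moreover have "0 \<le> liminf ?f"
    by (intro Liminf_bounded always_eventually) (simp add: int_dist_nonneg)
  ultimately show ?thesis using irr by (simp add: well_approximable_def)
qed

section \<open>Continued fractions with sparse jumps\<close>

text \<open>The jump quotient at a position of \<open>S\<close> depends on the preceding denominator, so the denominators
  are defined first.\<close>

fun jump_den :: "nat set \<Rightarrow> nat \<Rightarrow> nat" where
  "jump_den S 0 = 1"
| "jump_den S (Suc 0) = 2"
| "jump_den S (Suc (Suc n)) =
     (if Suc (Suc n) \<in> S then 2 * jump_den S (Suc n) ^ Suc n else 2) * jump_den S (Suc n) + jump_den S n"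

text \<open>Truncated subtraction and the exponent 0 give positions 0 and 1 the quotient 2 even if
  they lie in \<open>S\<close>, in accordance with \<open>jump_den S (Suc 0) = 2\<close>. The factor
  2 keeps every jump quotient at least 2.\<close>

definition jump_quotient :: "nat set \<Rightarrow> nat \<Rightarrow> nat" where
  "jump_quotient S n = (if n \<in> S then 2 * jump_den S (n - 1) ^ (n - 1) else 2)"

definition jump_number :: "nat set \<Rightarrow> real" where
  "jump_number S = cf_value (jump_quotient S)"

lemma cf_den_jump_quotient: "cf_den (jump_quotient S) n = jump_den S n"
  by (induction n rule: jump_den.induct[of _ S]) (auto simp: jump_quotient_def)

lemma jump_den_pos: "jump_den S n > 0"
  by (induction n rule: jump_den.induct[of _ S]) auto

interpretation jump: continued_fraction "jump_quotient S" for S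
  by unfold_locales (use jump_den_pos in \<open>auto simp: jump_quotient_def Suc_le_eq\<close>)

text \<open>The denominators q_k just before the jumps are the required multipliers: the error at
  q_k is at most 1/q_(k+1) < q_k^(-k), and k >= \<kappa> for all but finitely many jumps.\<close>

lemma jump_number_liouville:
  assumes S: "infinite S"
  shows "jump_number S \<in> liouville_numbers"
  unfolding liouville_numbers_def
proof
  fix \<kappa> :: real assume "\<kappa> \<in> {1<..}"
  let ?q = "cf_den (jump_quotient S)"
  have "infinite (?q ` {k. Suc k \<in> S \<and> real k \<ge> \<kappa>})"
  proof -
    have "S \<subseteq> Suc ` {k. Suc k \<in> S \<and> real k \<ge> \<kappa>} \<union> {..nat \<lceil>\<kappa>\<rceil> + 1}"
    proof
      fix n assume "n \<in> S"
      show "n \<in> Suc ` {k. Suc k \<in> S \<and> real k \<ge> \<kappa>} \<union> {..nat \<lceil>\<kappa>\<rceil> + 1}"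
      proof (cases "n \<le> nat \<lceil>\<kappa>\<rceil> + 1")
        case False
        then obtain k where "n = Suc k" "real k \<ge> \<kappa>" by (cases n) (auto, linarith)
        with \<open>n \<in> S\<close> show ?thesis by auto
      qed simp
    qed
    with S have "infinite {k. Suc k \<in> S \<and> real k \<ge> \<kappa>}"
      using finite_subset by blast
    moreover have "inj_on ?q A" for A
      using jump.strict_mono_cf_den[of S] by (meson strict_mono_imp_inj_on inj_on_subset subset_UNIV)
    ultimately show ?thesis by (simp add: finite_image_iff)
  qed
  moreover have "?q ` {k. Suc k \<in> S \<and> real k \<ge> \<kappa>} \<subseteq>
      {n. int_dist (real n * jump_number S) < real n powr (- \<kappa>)}"
  proof clarify
    fix k assume k: "Suc k \<in> S" "real k \<ge> \<kappa>"
    have q: "real (?q k) \<ge> 1" using jump.cf_den_pos[of S k] by simp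
    \<comment> \<open>The factor 2 in the jump quotient supplies the strict inequality q_k^k <
      q_(k+1).\<close>
    have "2 * ?q k ^ k \<le> 2 * ?q k ^ k * ?q k" using jump.cf_den_pos[of S k] by simp
    also have "\<dots> \<le> ?q (Suc k)"
      using jump.cf_den_step[of S k] k by (simp add: jump_quotient_def cf_den_jump_quotient)
    finally have "2 * real (?q k) ^ k \<le> real (?q (Suc k))"
      by (metis of_nat_le_iff of_nat_mult of_nat_numeral of_nat_power)
    moreover have "0 < real (?q k) ^ k" using q by simp
    ultimately have "real (?q k) ^ k < real (?q (Suc k))" by linarith
    have "int_dist (real (?q k) * jump_number S) \<le> \<bar>jump.cf_err S k\<bar>"
      using int_dist_le[of _ "int (cf_num (jump_quotient S) k)"]
      by (simp add: jump.cf_err_def jump_number_def)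
    also have "\<dots> \<le> 1 / real (?q (Suc k))" by (rule jump.cf_err_le)
    also have "\<dots> < 1 / real (?q k) ^ k"
      using \<open>0 < real (?q k) ^ k\<close> \<open>real (?q k) ^ k < real (?q (Suc k))\<close>
      by (intro divide_strict_left_mono) auto
    also have "\<dots> = real (?q k) powr (- real k)"
      using q by (simp add: powr_minus powr_realpow field_simps)
    also have "\<dots> \<le> real (?q k) powr (- \<kappa>)" using k q by (intro powr_mono) auto
    finally show "int_dist (real (?q k) * jump_number S) < real (?q k) powr (- \<kappa>)" .
  qed
  ultimately have "infinite {n. int_dist (real n * jump_number S) < real n powr (- \<kappa>)}"
    using finite_subset by blast
  then show "jump_number S \<in> kappa_approximable_real \<kappa>"
    unfolding kappa_approximable_real_def using jump.cf_value_irrational by (simp add: jump_number_def)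
qed

text \<open>A bound on the denominators that is uniform in \<open>S\<close>, so that the jump positions of both numbers
  can be chosen before the numbers are known.\<close>

primrec den_bound :: "nat \<Rightarrow> nat" where
  "den_bound 0 = 2"
| "den_bound (Suc n) = (2 * den_bound n ^ n + 1) * den_bound n"

lemma den_bound_ge: "n + 2 \<le> den_bound n"
proof (induction n)
  case (Suc n)
  have "den_bound n ^ n > 0" using Suc by (simp add: zero_less_power)
  then have "3 * den_bound n \<le> den_bound (Suc n)"
    unfolding den_bound.simps by (intro mult_le_mono) auto
  with Suc show ?case by linarith
qed simp

lemma cf_den_le_den_bound: "cf_den (jump_quotient S) n \<le> den_bound n"
proof (induction n)
  case (Suc n)
  have "den_bound n ^ n > 0" using den_bound_ge[of n] by (intro zero_less_power) simp
  moreover have "cf_den (jump_quotient S) n ^ n \<le> den_bound n ^ n" using Suc by (rule power_mono) simp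
  ultimately have "jump_quotient S (Suc n) \<le> 2 * den_bound n ^ n"
    by (auto simp: jump_quotient_def cf_den_jump_quotient)
  then have "(jump_quotient S (Suc n) + 1) * cf_den (jump_quotient S) n \<le> den_bound (Suc n)"
    unfolding den_bound.simps using Suc by (intro mult_le_mono) auto
  then show ?case using jump.cf_den_step_le[of S n] by linarith
qed simp

text \<open>The gap exceeds every denominator that can occur at the preceding jump position. As the
  l-th denominator is at least 2^l > l, the next jump starts beyond the denominator where the
  preceding one ends, even if the two belong to different numbers.\<close>

primrec jump_pos :: "nat \<Rightarrow> nat" where
  "jump_pos 0 = 1"
| "jump_pos (Suc j) = jump_pos j + den_bound (jump_pos j) + 1"

text \<open>The values e = 0 and e = 1 distribute the jump positions alternately between the two
  numbers.\<close>

definition jump_set :: "nat \<Rightarrow> nat set" where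
  "jump_set e = range (\<lambda>j. jump_pos (2 * j + e))"

lemma strict_mono_jump_pos: "strict_mono jump_pos"
  by (simp add: strict_mono_Suc_iff)

lemma jump_pos_ge: "j \<le> jump_pos j"
  by (rule strict_mono_imp_increasing[OF strict_mono_jump_pos])

lemma infinite_jump_set: "infinite (jump_set e)"
proof -
  have "inj (\<lambda>j. jump_pos (2 * j + e))"
    by (rule injI) (use strict_mono_eq[OF strict_mono_jump_pos] in auto)
  then show ?thesis unfolding jump_set_def by (rule range_inj_infinite)
qed

text \<open>The blocks are the stretches strictly between consecutive jumps of this number, where
  all quotients are 2.\<close>

lemma abyssal_jump_number: "abyssal (jump_number (jump_set e))"
  unfolding abyssal_def
proof (intro conjI exI)
  let ?i = "\<lambda>n. jump_pos (2 * n + e) + 1"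
  \<comment> \<open>A block starts one past a jump and stops one before the next, hence the 2. The
    bound \<open>gap\<close> keeps the truncated subtraction exact.\<close>
  let ?k = "\<lambda>n. jump_pos (2 * n + e + 2) - jump_pos (2 * n + e) - 2"
  have gap: "jump_pos (2 * n + e) + n + 2 \<le> jump_pos (2 * n + e + 2)" for n
    using den_bound_ge[of "jump_pos (2 * n + e)"] jump_pos_ge[of "2 * n + e"] by simp
  have block: "{?i n .. ?i n + ?k n} = {jump_pos (2 * n + e) <..< jump_pos (2 * n + e + 2)}" for n
    using gap[of n] by auto
  have mono: "jump_pos i \<le> jump_pos j" if "i \<le> j" for i j
    using strict_mono_less_eq[OF strict_mono_jump_pos] that by simp
  show "jump_number (jump_set e) \<notin> \<rat>"
    unfolding jump_number_def by (rule jump.cf_value_irrational)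
  show "disjoint_family (\<lambda>n. {?i n .. ?i n + ?k n})"
    unfolding block disjoint_family_on_def
  proof (intro ballI impI)
    have *: "{jump_pos (2 * m + e) <..< jump_pos (2 * m + e + 2)} \<inter>
        {jump_pos (2 * n + e) <..< jump_pos (2 * n + e + 2)} = {}" if "m < n" for m n
      using mono[of "2 * m + e + 2" "2 * n + e"] that by auto
    fix m n :: nat assume "m \<noteq> n"
    then show "{jump_pos (2 * m + e) <..< jump_pos (2 * m + e + 2)} \<inter>
        {jump_pos (2 * n + e) <..< jump_pos (2 * n + e + 2)} = {}"
      using *[of m n] *[of n m] by (metis Int_commute linorder_neqE_nat)
  qed
  show "\<forall>n. \<forall>j\<in>{?i n .. ?i n + ?k n}. partial_quotient (jump_number (jump_set e)) j \<le> 2"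
    unfolding block
  proof (intro allI ballI)
    fix n j assume j: "j \<in> {jump_pos (2 * n + e) <..< jump_pos (2 * n + e + 2)}"
    have "j \<notin> jump_set e"
    proof
      assume "j \<in> jump_set e"
      then obtain l where "j = jump_pos (2 * l + e)" by (auto simp: jump_set_def)
      with j have "2 * n + e < 2 * l + e" "2 * l + e < 2 * n + e + 2"
        using strict_mono_less[OF strict_mono_jump_pos] by (auto simp del: jump_pos.simps)
      then show False by presburger
    qed
    then show "partial_quotient (jump_number (jump_set e)) j \<le> 2"
      by (simp add: jump_number_def jump.partial_quotient_cf_value jump_quotient_def)
  qed
  show "filterlim ?k at_top sequentially"
  proof (rule filterlim_at_top_mono[OF filterlim_ident], intro always_eventually allI)
    show "n \<le> ?k n" for n using gap[of n] by linarith
  qed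
qed

text \<open>\<open>den_bound (Suc k)\<close> lies between the two sides: it bounds the earlier
  denominator for any \<open>S\<close>, and it is at most l by the choice of
  \<open>jump_pos\<close>, hence below 2^l.\<close>

lemma cf_den_jump_separated:
  assumes "Suc k = jump_pos i" "Suc l = jump_pos j" "i < j"
  shows "cf_den (jump_quotient S) (Suc k) \<le> cf_den (jump_quotient S') l"
proof -
  have "jump_pos (Suc i) \<le> jump_pos j"
    using strict_mono_less_eq[OF strict_mono_jump_pos] assms(3) by (simp del: jump_pos.simps)
  then have l: "den_bound (Suc k) \<le> l" using assms(1,2) by simp
  have "cf_den (jump_quotient S) (Suc k) \<le> den_bound (Suc k)" by (rule cf_den_le_den_bound)
  also have "\<dots> \<le> l" by (rule l)
  also have "\<dots> \<le> 2 ^ l" by (rule less_imp_le) (rule less_exp)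
  also have "\<dots> \<le> cf_den (jump_quotient S') l" by (rule jump.cf_den_ge_power)
  finally show ?thesis .
qed

text \<open>The standard core of the theorem; t stands for the inverse of a representative of \<mu>.
  Both approximations would place t in a jump interval of each number. These jumps have indices of
  opposite parity, and intervals of different jumps do not meet.\<close>

lemma jump_numbers_not_both_approximable:
  fixes n m n' m' :: int and t C :: real
  assumes "C > 0"
    and "n \<noteq> 0" "6 * C * \<bar>of_int n\<bar> < t"
      "t * \<bar>of_int n * jump_number (jump_set 0) - of_int m\<bar> \<le> C"
    and "n' \<noteq> 0" "6 * C * \<bar>of_int n'\<bar> < t"
      "t * \<bar>of_int n' * jump_number (jump_set 1) - of_int m'\<bar> \<le> C"
  shows False
proof -
  obtain k where k: "jump_quotient (jump_set 0) (Suc k) > 2"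
      "6 * C * real (cf_den (jump_quotient (jump_set 0)) k) < t"
      "t \<le> 2 * C * real (cf_den (jump_quotient (jump_set 0)) (Suc k))"
    using jump.cf_value_approx_imp_large_quotient[OF assms(2,1,3), of "jump_set 0" m] assms(4)
    unfolding jump_number_def by blast
  obtain l where l: "jump_quotient (jump_set 1) (Suc l) > 2"
      "6 * C * real (cf_den (jump_quotient (jump_set 1)) l) < t"
      "t \<le> 2 * C * real (cf_den (jump_quotient (jump_set 1)) (Suc l))"
    using jump.cf_value_approx_imp_large_quotient[OF assms(5,1,6), of "jump_set 1" m'] assms(7)
    unfolding jump_number_def by blast
  have "Suc k \<in> jump_set 0" "Suc l \<in> jump_set 1"
    using k(1) l(1) by (auto simp: jump_quotient_def split: if_splits)
  then obtain i j where i: "Suc k = jump_pos (2 * i)" and j: "Suc l = jump_pos (2 * j + 1)"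
    by (auto simp: jump_set_def)
  \<comment> \<open>Here x ends the earlier jump and y starts the later one.\<close>
  have contra: False
    if "x \<le> y" "6 * C * real y < t" "t \<le> 2 * C * real x" for x y :: nat
  proof -
    have "2 * C * real x \<le> 2 * C * real y" using that(1) \<open>C > 0\<close> by (intro mult_left_mono) auto
    moreover have "2 * C * real y \<le> 6 * C * real y" using \<open>C > 0\<close> by (intro mult_right_mono) auto
    ultimately show False using that by linarith
  qed
  have "2 * i \<noteq> 2 * j + 1" by presburger
  then consider "2 * i < 2 * j + 1" | "2 * j + 1 < 2 * i" by linarith
  then show False
  proof cases
    case 1
    show False by (rule contra[OF cf_den_jump_separated[OF i j 1] l(2) k(3)])
  next
    case 2
    show False by (rule contra[OF cf_den_jump_separated[OF j i 2] k(2) l(3)])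
  qed
qed

section \<open>Unwinding the ultrapower\<close>

lemma gd_refl:
  assumes U: "nonprincipal_ultrafilter U" and f: "eventually (\<lambda>i. f i \<ge> 0) U"
  shows "ultra_class U f \<in> gd_rel U `` {ultra_class U f}"
proof -
  \<comment> \<open>Nonnegative hyperreals are encoded as positive or zero, so the ultrafilter must
    decide between the cases.\<close>
  have "eventually (\<lambda>i. f i = 0) U \<or> eventually (\<lambda>i. f i \<noteq> 0) U"
    using U by (auto simp: nonprincipal_ultrafilter_def)
  then have "ultra_class U f \<in> nonneg_hyperreals U"
  proof
    assume "eventually (\<lambda>i. f i = 0) U"
    then show ?thesis by (simp add: nonneg_hyperreals_def ultra_simps)
  next
    assume "eventually (\<lambda>i. f i \<noteq> 0) U"
    with f have "eventually (\<lambda>i. 0 < f i) U" by eventually_elim simp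
    then show ?thesis by (rule positive_class_mem_nonneg)
  qed
  moreover have "ultra_class U (\<lambda>_. 1) \<in> positive_bounded_units U"
    unfolding mem_positive_bounded_units[OF U]
    by (intro exI[of _ "\<lambda>_. 1"] exI[of _ "1::real"]) simp
  moreover have "ultra_class U f = h_times U (ultra_class U (\<lambda>_. 1)) (ultra_class U f)"
    by (simp add: ultra_map2_class)
  ultimately show ?thesis by (auto simp: gd_rel_def)
qed

text \<open>The strict order on classes compares all representatives. Every c f with standard c > 0
  represents \<mu>, so the growth condition holds for all c, while the decay condition provides just
  one constant C.\<close>

lemma gd_approx_group_nonzero:
  assumes U: "nonprincipal_ultrafilter U" and f: "eventually (\<lambda>i. 0 < f i) U"
    and ne: "gd_approx_group U (gd U (ultra_class U f)) (gd U (ultra_class U f)) \<theta> \<noteq> {h_zero U}"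
  obtains g h :: "nat \<Rightarrow> int" and C :: real where
    "eventually (\<lambda>i. g i \<noteq> 0) U"
    "\<forall>c>0. eventually (\<lambda>i. c * f i < inverse \<bar>of_int (g i)\<bar>) U"
    "eventually (\<lambda>i. \<bar>of_int (g i) * \<theta> - of_int (h i)\<bar> \<le> C * f i) U"
proof -
  let ?\<mu> = "gd U (ultra_class U f)"
  have "ultra_class U (\<lambda>i. \<bar>f i\<bar>) = ultra_class U f"
    unfolding ultra_class_eq_iff using f by eventually_elim simp
  then have \<mu>: "?\<mu> = gd_rel U `` {ultra_class U f}"
    by (simp add: gd_def ultra_map_class)
  from ne obtain n where n: "n \<in> approx_group U \<theta>" "n \<noteq> h_zero U"
      "gd_less U ?\<mu> (growth U n)" "gd_le U (decay U \<theta> n) ?\<mu>"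
    unfolding gd_approx_group_def by blast
  then obtain m where m: "n \<in> hyperints U" "m \<in> hyperints U"
      "h_minus U (h_times U n (ultra_const U \<theta>)) m \<in> infinitesimals U"
    by (auto simp: approx_group_def)
  then obtain g h :: "nat \<Rightarrow> int" where g: "n = ultra_class U (\<lambda>i. of_int (g i))"
    and h: "m = ultra_class U (\<lambda>i. of_int (h i))"
    by (auto simp: hyperints_def ultrapower_eq ultra_map_class)
  have g0: "eventually (\<lambda>i. g i \<noteq> 0) U"
    using n(2) U by (auto simp: g ultra_simps nonprincipal_ultrafilter_def)
  have gpos: "eventually (\<lambda>i. 0 < \<bar>real_of_int (g i)\<bar>) U"
    using g0 by eventually_elim simp
  have "growth U n = gd_rel U `` {ultra_class U (\<lambda>i. inverse \<bar>real_of_int (g i)\<bar>)}"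
    by (simp add: growth_def gd_def g ultra_map_class gd_inverse_pos[OF U gpos])
  moreover have "ultra_class U (\<lambda>i. inverse \<bar>real_of_int (g i)\<bar>) \<in>
      gd_rel U `` {ultra_class U (\<lambda>i. inverse \<bar>real_of_int (g i)\<bar>)}"
    by (rule gd_refl[OF U]) simp
  ultimately have less: "h_less U x (ultra_class U (\<lambda>i. inverse \<bar>real_of_int (g i)\<bar>))" if "x \<in> ?\<mu>" for x
    using n(3) that by (auto simp: gd_less_def)
  have growth: "eventually (\<lambda>i. c * f i < inverse \<bar>of_int (g i)\<bar>) U" if "c > 0" for c
  proof -
    have "ultra_class U (\<lambda>i. c * f i) \<in> ?\<mu>"
      unfolding \<mu> mem_gd_pos[OF U f] using that
      by (intro exI[of _ "\<lambda>_. c"] exI[of _ c]) simp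
    from less[OF this] show ?thesis by (simp add: ultra_lift2_class)
  qed
  let ?e = "\<lambda>i. of_int (g i) * \<theta> - of_int (h i)"
  \<comment> \<open>\<open>dual\<close> is a definite description; by uniqueness the witness m from
    \<open>approx_group\<close> is its value.\<close>
  have "dual U \<theta> n = m"
    unfolding dual_def
  proof (rule the_equality)
    fix m' assume "m' \<in> hyperints U \<and> h_minus U (h_times U n (ultra_const U \<theta>)) m' \<in> infinitesimals U"
    then show "m' = m" using dual_unique[OF _ _ m(2,3,1)] by blast
  qed (intro conjI m)
  then have decay: "decay U \<theta> n = gd_rel U `` {ultra_class U (\<lambda>i. \<bar>?e i\<bar>)}"
    by (simp add: decay_def error_term_def gd_def g h ultra_const_def ultra_map2_class ultra_map_class)
  have mem: "ultra_class U (\<lambda>i. \<bar>?e i\<bar>) \<in> decay U \<theta> n"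
    unfolding decay by (rule gd_refl[OF U]) simp
  have "\<exists>C. eventually (\<lambda>i. \<bar>?e i\<bar> \<le> C * f i) U"
  \<comment> \<open>Strict inequality of classes gives C = 1; under equality C is an upper bound of
    the unit relating the representatives.\<close>
  proof (cases "gd_less U (decay U \<theta> n) ?\<mu>")
    case True
    moreover have "ultra_class U f \<in> ?\<mu>"
      unfolding \<mu> by (rule gd_refl[OF U]) (rule eventually_mono[OF f], simp)
    ultimately have "h_less U (ultra_class U (\<lambda>i. \<bar>?e i\<bar>)) (ultra_class U f)"
      using mem unfolding gd_less_def by (elim ballE) auto
    then have "eventually (\<lambda>i. \<bar>?e i\<bar> < f i) U" unfolding ultra_lift2_class .
    then have "eventually (\<lambda>i. \<bar>?e i\<bar> \<le> 1 * f i) U" by eventually_elim simp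
    then show ?thesis by blast
  next
    case False
    then have "decay U \<theta> n = ?\<mu>" using n(4) by (simp add: gd_le_def)
    with mem have "ultra_class U (\<lambda>i. \<bar>?e i\<bar>) \<in> gd_rel U `` {ultra_class U f}"
      by (simp only: \<mu>)
    then obtain c a b where c: "ultra_class U (\<lambda>i. \<bar>?e i\<bar>) = ultra_class U (\<lambda>i. c i * f i)"
        "eventually (\<lambda>i. a \<le> c i \<and> c i \<le> b) U"
      unfolding mem_gd_pos[OF U f] by blast
    have "eventually (\<lambda>i. \<bar>?e i\<bar> \<le> b * f i) U"
      using c(1)[unfolded ultra_class_eq_iff] c(2) f
      by eventually_elim (simp add: mult_right_mono)
    then show ?thesis by blast
  qed
  then obtain C where "eventually (\<lambda>i. \<bar>?e i\<bar> \<le> C * f i) U" ..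
  with g0 growth show thesis by (intro that) auto
qed

lemma jump_numbers_flat_product_undefined:
  assumes U: "nonprincipal_ultrafilter U" and \<mu>: "\<mu> \<in> gd_infinitesimal U"
    and ne: "gd_approx_group U \<mu> \<mu> (jump_number (jump_set 0)) \<noteq> {h_zero U}"
      "gd_approx_group U \<mu> \<mu> (jump_number (jump_set 1)) \<noteq> {h_zero U}"
  shows False
proof -
  obtain f where \<mu>f: "\<mu> = gd U (ultra_class U f)" and f: "eventually (\<lambda>i. 0 < f i) U"
    using \<mu> by (auto simp: gd_infinitesimal_def infinitesimals_def hyperreals_def ultrapower_eq ultra_simps)
  obtain g h C where 1: "eventually (\<lambda>i. g i \<noteq> 0) U"
    "\<forall>c>0. eventually (\<lambda>i. c * f i < inverse \<bar>of_int (g i)\<bar>) U"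
    "eventually (\<lambda>i. \<bar>of_int (g i) * jump_number (jump_set 0) - of_int (h i)\<bar> \<le> C * f i) U"
    by (rule gd_approx_group_nonzero[OF U f ne(1)[unfolded \<mu>f]]) (rule that)
  obtain g' h' C' where 2: "eventually (\<lambda>i. g' i \<noteq> 0) U"
    "\<forall>c>0. eventually (\<lambda>i. c * f i < inverse \<bar>of_int (g' i)\<bar>) U"
    "eventually (\<lambda>i. \<bar>of_int (g' i) * jump_number (jump_set 1) - of_int (h' i)\<bar> \<le> C' * f i) U"
    by (rule gd_approx_group_nonzero[OF U f ne(2)[unfolded \<mu>f]]) (rule that)
  \<comment> \<open>One constant serves both numbers; the 1 makes it positive, as C and C' have no
    known sign.\<close>
  define D where "D = max 1 (max C C')"
  have D: "D > 0" "C \<le> D" "C' \<le> D" by (auto simp: D_def)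
  have size: "6 * D * \<bar>of_int n\<bar> < inverse x"
    if "x > 0" "n \<noteq> 0" "6 * D * x < inverse \<bar>of_int n\<bar>" for x :: real and n :: int
    using that by (simp add: field_simps)
  have err: "inverse x * \<bar>e\<bar> \<le> D" if "x > 0" "\<bar>e\<bar> \<le> K * x" "K \<le> D" for x e K :: real
  proof -
    have "\<bar>e\<bar> \<le> D * x" using that mult_right_mono[of K D x] by linarith
    then show ?thesis using that by (simp add: field_simps)
  qed
  \<comment> \<open>The growth condition is used with c = 6 D, matching the factor 6 in
    \<open>jump_numbers_not_both_approximable\<close> for t = \<open>inverse (f i)\<close>.\<close>
  have D6: "6 * D > 0" using D by simp
  \<comment> \<open>The finitely many conditions hold together on a set of the ultrafilter, and a
    single index in it is already contradictory.\<close>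
  have "eventually (\<lambda>i. False) U"
    using f 1(1) 1(2)[rule_format, OF D6] 1(3) 2(1) 2(2)[rule_format, OF D6] 2(3)
  proof eventually_elim
    case (elim i)
    show False
      by (rule jump_numbers_not_both_approximable[OF D(1) elim(2) size[OF elim(1,2,3)]
          err[OF elim(1) elim(4) D(2)] elim(5) size[OF elim(1,5,6)] err[OF elim(1) elim(7) D(3)]])
  qed
  with U show False by (simp add: nonprincipal_ultrafilter_def trivial_limit_def)
qed

theorem theorem15:
  fixes U :: "nat filter"
  assumes "nonprincipal_ultrafilter U"
  shows "(\<exists>\<theta> \<eta>. abyssal \<theta> \<and> abyssal \<eta> \<and>
            \<theta> \<in> well_approximable \<and> \<eta> \<in> well_approximable \<and>
            (\<forall>\<mu>\<in>gd_infinitesimal U.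
               \<not> (gd_approx_group U \<mu> \<mu> \<theta> \<noteq> {h_zero U} \<and>
                  gd_approx_group U \<mu> \<mu> \<eta> \<noteq> {h_zero U})))
       \<and> (\<forall>\<kappa>\<in>{1..\<infinity>::ereal}. \<forall>\<kappa>'\<in>{1..\<infinity>::ereal}.
            \<exists>\<theta> \<eta>. abyssal \<theta> \<and> abyssal \<eta> \<and>
              \<theta> \<in> well_approximable \<and> \<eta> \<in> well_approximable \<and>
              \<theta> \<in> kappa_approximable \<kappa> \<and> \<eta> \<in> kappa_approximable \<kappa>' \<and>
              (\<forall>\<mu>\<in>gd_infinitesimal U.
                 \<not> (gd_approx_group U \<mu> \<mu> \<theta> \<noteq> {h_zero U} \<and>
                    gd_approx_group U \<mu> \<mu> \<eta> \<noteq> {h_zero U})))"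
proof -
  have L: "jump_number (jump_set e) \<in> liouville_numbers" for e
    by (rule jump_number_liouville[OF infinite_jump_set])
  let ?\<theta> = "jump_number (jump_set 0)" and ?\<eta> = "jump_number (jump_set 1)"
  have undefined_product: "\<forall>\<mu>\<in>gd_infinitesimal U. \<not> (gd_approx_group U \<mu> \<mu> ?\<theta> \<noteq> {h_zero U} \<and>
      gd_approx_group U \<mu> \<mu> ?\<eta> \<noteq> {h_zero U})"
    by (intro ballI notI, elim conjE) (rule jump_numbers_flat_product_undefined[OF assms])
  have \<theta>: "abyssal ?\<theta>" "?\<theta> \<in> well_approximable" "\<kappa> \<in> {1..\<infinity>} \<Longrightarrow> ?\<theta> \<in> kappa_approximable \<kappa>"
    and \<eta>: "abyssal ?\<eta>" "?\<eta> \<in> well_approximable" "\<kappa> \<in> {1..\<infinity>} \<Longrightarrow> ?\<eta> \<in> kappa_approximable \<kappa>" for \<kappa>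
    by (intro abyssal_jump_number liouville_well_approximable[OF L] liouville_kappa_approximable[OF L];
        assumption)+
  show ?thesis
  proof (intro conjI ballI, goal_cases)
    case 1
    show ?case by (rule exI[of _ ?\<theta>], rule exI[of _ ?\<eta>]) (intro conjI \<theta> \<eta> undefined_product)
  next
    case (2 \<kappa> \<kappa>')
    show ?case
      by (rule exI[of _ ?\<theta>], rule exI[of _ ?\<eta>]) (intro conjI \<theta> \<eta> undefined_product 2)
  qed
qed

end
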